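(* Let $G=\theta_{d_1,\dots,d_\ell}$ be a generalized theta graph with $\ell\ge1$ paths and $d_i\ge3$ for all $i$. Then Broadcast is solvable on $G$ with $k$ ignorant agents if and only if $k\ge \ell$.
   Context: Generalized theta graph: $\theta_{d_1,\dots,d_\ell}$ consists of two distinct fixed nodes $N,S$ (the poles) joined by $\ell$ internally vertex-disjoint paths, the $i$-th of which has exactly $d_i$ internal nodes. Broadcast model: a connected base graph $G=(V,E)$ with $n$ nodes. There is one source agent holding a message $\mathcal M$ and $k\ge1$ ignorant agents (agents not holding $\mathcal M$); initially all agents occupy pairwise distinct nodes, the initial placement being chosen by the adversary. Time proceeds in synchronous rounds; in each round: (1) the adversary removes a (possibly empty) set $E'\subseteq E$ of edges such that $(V,E\setminus E')$ is connected; (2) each agent (agents have unique IDs, local memory, and see the entire current graph, the positions of all agents and which agents hold $\mathcal M$) chooses either to stay or to traverse an edge of $E\setminus E'$ incident to its current node; (3) agents move. Whenever an ignorant agent is at the same node as an agent holding $\mathcal M$, it receives $\mathcal M$ and becomes a source agent. The adversary is adaptive and knows the agents' strategy. Broadcast is solvable on $G$ with $k$ ignorant agents if the agents have a strategy such that, for every initial placement and every adversary behaviour, after finitely many rounds all agents hold $\mathcal M$; otherwise the adversary is said to have a winning strategy. *)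

theory Defs
  imports Main
begin

section \<open>Dynamic graphs and the Broadcast game\<close>

text \<open>A graph is a vertex set V and a set E of undirected edges, each edge being a
  two-element set of vertices.\<close>

definition adj :: "'v set set \<Rightarrow> ('v \<times> 'v) set" where
  "adj F = {(u, v). {u, v} \<in> F \<and> u \<noteq> v}"

definition graph_connected :: "'v set \<Rightarrow> 'v set set \<Rightarrow> bool" where
  "graph_connected V F \<longleftrightarrow> (\<forall>u\<in>V. \<forall>v\<in>V. (u, v) \<in> (adj F)\<^sup>*)"

text \<open>Agents are numbered 0..k; agent 0 is the (initial) source agent, agents 1..k are
  the k ignorant agents. A configuration records the position of every agent and the set
  of agents holding the message.\<close>

type_synonym 'v conf = "(nat \<Rightarrow> 'v) \<times> nat set"

text \<open>A (deterministic, full-information) strategy of the agents: given the initial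
  configuration, the history of the previous rounds (for each round the set of removed
  edges and the configuration reached at its end) and the set of edges removed in the
  current round, it prescribes for every agent a target node. A target is only followed
  if it equals the current node (stay) or is joined to it by a present edge; otherwise
  the agent stays.\<close>

type_synonym 'v strategy =
  "'v conf \<Rightarrow> ('v set set \<times> 'v conf) list \<Rightarrow> 'v set set \<Rightarrow> nat \<Rightarrow> 'v"

definition cur_conf :: "'v conf \<Rightarrow> ('v set set \<times> 'v conf) list \<Rightarrow> 'v conf" where
  "cur_conf c0 h = (if h = [] then c0 else snd (last h))"

definition step :: "nat \<Rightarrow> 'v set set \<Rightarrow> 'v conf \<Rightarrow> (nat \<Rightarrow> 'v) \<Rightarrow> 'v conf" where
  "step k F c tgt =
     (let pos = fst c; inf = snd c;
          npos = (\<lambda>a. if tgt a = pos a \<or> {pos a, tgt a} \<in> F then tgt a else pos a)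
      in (npos, inf \<union> {a. a \<le> k \<and> (\<exists>b\<in>inf. b \<le> k \<and> npos b = npos a)}))"

text \<open>The history after t rounds, for edge set E, strategy, initial configuration and
  adversary's removal sequence R (R t is the set removed in round t).\<close>

fun run :: "nat \<Rightarrow> 'v set set \<Rightarrow> 'v strategy \<Rightarrow> 'v conf \<Rightarrow> (nat \<Rightarrow> 'v set set) \<Rightarrow> nat
              \<Rightarrow> ('v set set \<times> 'v conf) list" where
  "run k E \<sigma> c0 R 0 = []"
| "run k E \<sigma> c0 R (Suc t) =
     (let h = run k E \<sigma> c0 R t
      in h @ [(R t, step k (E - R t) (cur_conf c0 h) (\<sigma> c0 h (R t)))])"

text \<open>Broadcast is solvable on (V,E) with k ignorant agents: there is a strategy such
  that for every initial placement of the k+1 agents on pairwise distinct nodes and every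
  admissible adversary behaviour, eventually all agents hold the message. Since the agents'
  strategy is deterministic and known to the adversary, an adaptive adversary is
  equivalent to an arbitrary admissible sequence of removal sets.\<close>

definition broadcast_solvable :: "'v set \<Rightarrow> 'v set set \<Rightarrow> nat \<Rightarrow> bool" where
  "broadcast_solvable V E k \<longleftrightarrow>
     (\<exists>\<sigma> :: 'v strategy. \<forall>p0. inj_on p0 {0..k} \<and> p0 ` {0..k} \<subseteq> V \<longrightarrow>
        (\<forall>R. (\<forall>t. R t \<subseteq> E \<and> graph_connected V (E - R t)) \<longrightarrow>
           (\<exists>t. {0..k} \<subseteq> snd (cur_conf (p0, {0}) (run k E \<sigma> (p0, {0}) R t)))))"

section \<open>Generalized theta graphs\<close>

datatype tvert = North | South | Inner nat nat

text \<open>Path i (for i < l) is North, Inner i 0, ..., Inner i (d i - 1), South.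
  path_node l d i j is its j-th node, j = 0 .. d i + 1.\<close>

definition path_node :: "(nat \<Rightarrow> nat) \<Rightarrow> nat \<Rightarrow> nat \<Rightarrow> tvert" where
  "path_node d i j = (if j = 0 then North else if j = Suc (d i) then South else Inner i (j - 1))"

definition theta_V :: "nat \<Rightarrow> (nat \<Rightarrow> nat) \<Rightarrow> tvert set" where
  "theta_V l d = {North, South} \<union> {Inner i j | i j. i < l \<and> j < d i}"

definition theta_E :: "nat \<Rightarrow> (nat \<Rightarrow> nat) \<Rightarrow> tvert set set" where
  "theta_E l d = {{path_node d i j, path_node d i (Suc j)} | i j. i < l \<and> j \<le> d i}"

end

theory Submission
  imports Defs
begin

text \<open>An admissible removal takes at most one edge from each path and leaves some path intact.

  For \<open>k < l\<close> the adversary keeps one of the two sides of the source free of ignorant agents. It can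
  cut all paths but one: either some path other than the source's holds no ignorant agent and is
  left intact, or every other path holds exactly one, and each of these can be confined to the
  interior of its path by a single cut.

  For \<open>k \<ge> l\<close> consider the informed and the ignorant agents as two colours. An agent with the other
  colour on both sides of it along a path is eventually met, as only one side can be blocked. An
  agent waiting at a pole forces a meeting as well: the remaining \<open>k \<ge> l\<close> agents spread over the
  paths, and the intact path always allows progress. Finally some agent can reach a pole,
  because two of the \<open>k + 1 > l\<close> agents share a path and walk towards opposite ends of it.\<close>

section \<open>Reducing solvability to a positional game\<close>

definition admissible :: "'v set \<Rightarrow> 'v set set \<Rightarrow> 'v set set \<Rightarrow> bool" where
  "admissible V E R \<longleftrightarrow> R \<subseteq> E \<and> graph_connected V (E - R)"

text \<open>Histories and memory disappear: this is the attractor of the fully informed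
  configurations, a least fixed point in which the length of the play may depend on the adversary's
  choices.\<close>

inductive winning :: "'v set \<Rightarrow> 'v set set \<Rightarrow> nat \<Rightarrow> 'v conf \<Rightarrow> bool" for V E k where
  informed: "{0..k} \<subseteq> snd c \<Longrightarrow> winning V E k c"
| move: "(\<And>R. admissible V E R \<Longrightarrow> \<exists>tgt. winning V E k (step k (E - R) c tgt)) \<Longrightarrow> winning V E k c"

text \<open>A uniform bound on the number of rounds supplies the rank from which a strategy is
  extracted.\<close>

fun winning_in :: "'v set \<Rightarrow> 'v set set \<Rightarrow> nat \<Rightarrow> nat \<Rightarrow> 'v conf \<Rightarrow> bool" where
  "winning_in V E k 0 c \<longleftrightarrow> {0..k} \<subseteq> snd c"
| "winning_in V E k (Suc n) c \<longleftrightarrow>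
     (\<forall>R. admissible V E R \<longrightarrow> (\<exists>tgt. winning_in V E k n (step k (E - R) c tgt)))"

lemma snd_step_mono: "snd c \<subseteq> snd (step k F c tgt)"
  by (auto simp: step_def Let_def)

lemma winning_in_Suc: "winning_in V E k n c \<Longrightarrow> winning_in V E k (Suc n) c"
proof (induction n arbitrary: c)
  case 0
  have "{0..k} \<subseteq> snd (step k (E - R) c tgt)" for R tgt
    using 0 snd_step_mono[of c k "E - R" tgt] by auto
  then show ?case by simp
next
  case (Suc n)
  have "\<exists>tgt. winning_in V E k (Suc n) (step k (E - R) c tgt)" if "admissible V E R" for R
    using Suc.prems Suc.IH that unfolding winning_in.simps(2)[of V E k n c] by blast
  then show ?case by (simp only: winning_in.simps(2)[of V E k "Suc n" c]) blast
qed

lemma winning_in_mono: "m \<le> n \<Longrightarrow> winning_in V E k m c \<Longrightarrow> winning_in V E k n c"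
proof (induction n rule: dec_induct)
  case base
  then show ?case .
next
  case (step n)
  then show ?case by (intro winning_in_Suc)
qed

text \<open>The edge set has finitely many subsets, so the bounds for the individual removals have a
  maximum.\<close>

lemma winning_imp_winning_in:
  assumes "finite E" and "winning V E k c"
  shows "\<exists>n. winning_in V E k n c"
  using assms(2)
proof induction
  case (informed c)
  then show ?case by (intro exI[of _ 0]) simp
next
  case (move c)
  then have "\<forall>R. \<exists>n. admissible V E R \<longrightarrow> (\<exists>tgt. winning_in V E k n (step k (E - R) c tgt))"
    by blast
  then obtain N where N: "\<And>R. admissible V E R \<Longrightarrow>
      \<exists>tgt. winning_in V E k (N R) (step k (E - R) c tgt)"
    by metis
  have "finite (N ` Pow E)" using assms(1) by simp
  then have "N R \<le> Max (N ` Pow E)" if "admissible V E R" for R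
    using that by (intro Max_ge) (auto simp: admissible_def)
  with N have "winning_in V E k (Suc (Max (N ` Pow E))) c"
    unfolding winning_in.simps by (meson winning_in_mono)
  then show ?case by blast
qed

lemma cur_conf_run_Suc:
  "cur_conf c (run k E \<sigma> c R (Suc t)) =
   step k (E - R t) (cur_conf c (run k E \<sigma> c R t)) (\<sigma> c (run k E \<sigma> c R t) (R t))"
  by (simp add: cur_conf_def Let_def)

text \<open>Always moving so as to lower the rank of the current configuration is a strategy that
  needs no memory.\<close>

lemma broadcast_solvableI:
  assumes "finite E"
    and win: "\<And>p. inj_on p {0..k} \<Longrightarrow> p ` {0..k} \<subseteq> V \<Longrightarrow> winning V E k (p, {0})"
  shows "broadcast_solvable V E k"
proof -
  define rank where "rank c = (LEAST n. winning_in V E k n c)" for c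
  \<comment> \<open>At rank 0 the truncated difference is again 0 and every target qualifies, as the
    informed set never shrinks.\<close>
  define \<sigma> :: "'a strategy" where
    "\<sigma> c0 h R = (SOME tgt. winning_in V E k (rank (cur_conf c0 h) - 1)
                             (step k (E - R) (cur_conf c0 h) tgt))" for c0 h R
  show ?thesis unfolding broadcast_solvable_def
  proof (intro exI[of _ \<sigma>] allI impI)
    fix p and R :: "nat \<Rightarrow> 'a set set"
    assume p: "inj_on p {0..k} \<and> p ` {0..k} \<subseteq> V"
      and R: "\<forall>t. R t \<subseteq> E \<and> graph_connected V (E - R t)"
    define c where "c t = cur_conf (p, {0}) (run k E \<sigma> (p, {0}) R t)" for t
    obtain n where n: "winning_in V E k n (p, {0})"
      using winning_imp_winning_in[OF assms(1) win] p by metis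
    \<comment> \<open>Truncated subtraction: once \<open>t\<close> reaches \<open>n\<close> the
      bound is 0, meaning that all agents are informed.\<close>
    have "winning_in V E k (n - t) (c t)" for t
    proof (induction t)
      case 0
      then show ?case using n by (simp add: c_def cur_conf_def)
    next
      case (Suc t)
      let ?r = "rank (c t)"
      let ?tgt = "\<sigma> (p, {0}) (run k E \<sigma> (p, {0}) R t) (R t)"
      have r: "winning_in V E k ?r (c t)" and le: "?r \<le> n - t"
        unfolding rank_def using Suc by (auto intro: LeastI Least_le)
      have c_Suc: "c (Suc t) = step k (E - R t) (c t) ?tgt"
        unfolding c_def by (rule cur_conf_run_Suc)
      show ?case
      proof (cases ?r)
        case 0
        then have "winning_in V E k 0 (c (Suc t))"
          using r snd_step_mono[of "c t" k "E - R t" ?tgt] unfolding c_Suc by auto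
        then show ?thesis by (rule winning_in_mono[rotated]) simp
      next
        case (Suc m)
        with r R have "\<exists>tgt. winning_in V E k m (step k (E - R t) (c t) tgt)"
          by (auto simp: admissible_def)
        then have "winning_in V E k m (c (Suc t))"
          unfolding c_Suc \<sigma>_def c_def[symmetric] Suc diff_Suc_1 by (rule someI_ex)
        then show ?thesis by (rule winning_in_mono[rotated]) (use Suc le in linarith)
      qed
    qed
    from this[of n] show "\<exists>t. {0..k} \<subseteq> snd (cur_conf (p, {0}) (run k E \<sigma> (p, {0}) R t))"
      by (auto simp: c_def)
  qed
qed

text \<open>The adversary maintains an invariant that excludes full information. Solvability
  quantifies over removal sequences fixed in advance, so the adaptive play is first simulated
  against the deterministic strategy.\<close>

lemma not_broadcast_solvableI:
  assumes p: "inj_on p {0..k}" "p ` {0..k} \<subseteq> V"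
    and init: "Inv (p, {0})"
    and keep: "\<And>c. Inv c \<Longrightarrow> \<exists>R. admissible V E R \<and> (\<forall>tgt. Inv (step k (E - R) c tgt))"
    and ignorant: "\<And>c. Inv c \<Longrightarrow> \<not> {0..k} \<subseteq> snd c"
  shows "\<not> broadcast_solvable V E k"
proof
  assume "broadcast_solvable V E k"
  then obtain \<sigma> :: "'a strategy" where
    \<sigma>: "\<forall>p. inj_on p {0..k} \<and> p ` {0..k} \<subseteq> V \<longrightarrow> (\<forall>R. (\<forall>t. admissible V E (R t)) \<longrightarrow>
      (\<exists>t. {0..k} \<subseteq> snd (cur_conf (p, {0}) (run k E \<sigma> (p, {0}) R t))))"
    unfolding broadcast_solvable_def admissible_def by (elim exE)
  define adv where "adv c = (SOME R. admissible V E R \<and> (\<forall>tgt. Inv (step k (E - R) c tgt)))" for c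
  have adv: "admissible V E (adv c)" "Inv (step k (E - adv c) c tgt)" if "Inv c" for c tgt
    using someI_ex[OF keep[OF that]] unfolding adv_def by blast+
  \<comment> \<open>\<open>h\<close> is the history of the simulated play, built without reference
    to \<open>R\<close>; reading \<open>R\<close> off from \<open>h\<close> avoids a circular
    definition.\<close>
  define h where "h = rec_nat [] (\<lambda>_ h. let c = cur_conf (p, {0}) h
    in h @ [(adv c, step k (E - adv c) c (\<sigma> (p, {0}) h (adv c)))])"
  define R where "R t = adv (cur_conf (p, {0}) (h t))" for t
  have run: "run k E \<sigma> (p, {0}) R t = h t" for t
    by (induction t) (auto simp: h_def R_def Let_def)
  have inv: "Inv (cur_conf (p, {0}) (run k E \<sigma> (p, {0}) R t))" for t
  proof (induction t)
    case 0
    then show ?case using init by (simp add: cur_conf_def)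
  next
    case (Suc t)
    then have "Inv (cur_conf (p, {0}) (h t))" by (simp only: run)
    then show ?case unfolding cur_conf_run_Suc unfolding run unfolding R_def by (rule adv(2))
  qed
  then have "Inv (cur_conf (p, {0}) (h t))" for t
    by (simp only: run)
  then have "admissible V E (R t)" for t
    unfolding R_def by (rule adv(1))
  then obtain t where "{0..k} \<subseteq> snd (cur_conf (p, {0}) (run k E \<sigma> (p, {0}) R t))"
    using \<sigma>[rule_format, OF conjI[OF p], of R] by auto
  with ignorant[OF inv] show False by simp
qed

section \<open>Generalized theta graphs, up to exchanging the poles\<close>

text \<open>\<open>P i q\<close> is the \<open>q\<close>-th node of path \<open>i\<close>. The two ends \<open>P i 0\<close> and \<open>P i (Suc (d i))\<close> do not
  depend on \<open>i\<close>; keeping \<open>P\<close> abstract makes reversal of all paths an instance of the locale.\<close>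

locale theta =
  fixes l :: nat and d :: "nat \<Rightarrow> nat" and P :: "nat \<Rightarrow> nat \<Rightarrow> 'v" and V :: "'v set" and E :: "'v set set"
  assumes l_pos: "0 < l"
    and d_ge: "\<And>i. i < l \<Longrightarrow> 2 \<le> d i"
    and P_eq: "\<And>i j q r. \<lbrakk>i < l; j < l; q \<le> Suc (d i); r \<le> Suc (d j)\<rbrakk> \<Longrightarrow>
      P i q = P j r \<longleftrightarrow> (q = 0 \<and> r = 0) \<or> (q = Suc (d i) \<and> r = Suc (d j)) \<or> (i = j \<and> q = r)"
    and V_eq: "V = {P i q | i q. i < l \<and> q \<le> Suc (d i)}"
    and E_eq: "E = {{P i q, P i (Suc q)} | i q. i < l \<and> q \<le> d i}"
begin

abbreviation edge :: "nat \<Rightarrow> nat \<Rightarrow> 'v set" where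
  "edge i q \<equiv> {P i q, P i (Suc q)}"

text \<open>Counting every path from its other end exchanges the poles but leaves the graph
  unchanged, so facts about one pole transfer to the other.\<close>

lemma reversed: "theta l d (\<lambda>i q. P i (Suc (d i) - q)) V E"
proof
  show "P i (Suc (d i) - q) = P j (Suc (d j) - r) \<longleftrightarrow>
      (q = 0 \<and> r = 0) \<or> (q = Suc (d i) \<and> r = Suc (d j)) \<or> (i = j \<and> q = r)"
    if "i < l" "j < l" "q \<le> Suc (d i)" "r \<le> Suc (d j)" for i j q r
    using that P_eq[of i j "Suc (d i) - q" "Suc (d j) - r"] by auto
  show "V = {P i (Suc (d i) - q) | i q. i < l \<and> q \<le> Suc (d i)}"
    unfolding V_eq
  proof (safe, goal_cases)
    case (1 _ i q)
    then show ?case by (intro exI[of _ i] exI[of _ "Suc (d i) - q"]) auto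
  next
    case (2 _ i q)
    then show ?case by (intro exI[of _ i] exI[of _ "Suc (d i) - q"]) auto
  qed
  have rev: "{P i (Suc (d i) - q), P i (Suc (d i) - Suc q)} = edge i (d i - q)" if "q \<le> d i" for i q
    using that by (auto simp: Suc_diff_le)
  show "E = {{P i (Suc (d i) - q), P i (Suc (d i) - Suc q)} | i q. i < l \<and> q \<le> d i}"
    unfolding E_eq
  proof (intro set_eqI iffI; elim CollectE exE conjE)
    fix e i q assume "e = edge i q" "i < l" "q \<le> d i"
    then show "e \<in> {{P i (Suc (d i) - q), P i (Suc (d i) - Suc q)} | i q. i < l \<and> q \<le> d i}"
      using rev[of "d i - q" i] by (intro CollectI exI[of _ i] exI[of _ "d i - q"]) simp
  next
    fix e i q assume "e = {P i (Suc (d i) - q), P i (Suc (d i) - Suc q)}" "i < l" "q \<le> d i"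
    then show "e \<in> {edge i q | i q. i < l \<and> q \<le> d i}"
      using rev[of q i] by (intro CollectI exI[of _ i] exI[of _ "d i - q"]) simp
  qed
qed (use l_pos d_ge in auto)

lemma edge_in_E: "i < l \<Longrightarrow> q \<le> d i \<Longrightarrow> edge i q \<in> E"
  unfolding E_eq by blast

lemma edge_eq: "\<lbrakk>i < l; j < l; q \<le> d i; r \<le> d j\<rbrakk> \<Longrightarrow> edge i q = edge j r \<longleftrightarrow> i = j \<and> q = r"
  using d_ge[of i] d_ge[of j] by (auto simp: doubleton_eq_iff P_eq)

lemma finite_E: "finite E"
proof -
  have "E \<subseteq> (\<Union>i<l. edge i ` {..d i})" unfolding E_eq by auto
  then show ?thesis by (rule finite_subset) auto
qed

lemma edge_subset_V:
  assumes "e \<in> E" shows "e \<subseteq> V"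
proof -
  obtain i q where "e = edge i q" "i < l" "q \<le> d i" using assms unfolding E_eq by auto
  then have "P i q \<in> V" "P i (Suc q) \<in> V" unfolding V_eq using le_SucI by blast+
  then show ?thesis using \<open>e = edge i q\<close> by simp
qed

text \<open>The second part of each case identifies the traversed edge by its index, so that its
  presence can be checked against a removal set.\<close>

lemma neighbour_inner:
  assumes "{P i q, v} \<in> E" "i < l" "1 \<le> q" "q \<le> d i"
  obtains "v = P i (Suc q)" "edge i q = {P i q, v}" | "v = P i (q - 1)" "edge i (q - 1) = {P i q, v}"
proof -
  obtain j r where j: "j < l" "r \<le> d j" "{P i q, v} = edge j r"
    using assms(1) unfolding E_eq by auto
  then consider "P i q = P j r" "v = P j (Suc r)" | "P i q = P j (Suc r)" "v = P j r"
    by (auto simp: doubleton_eq_iff)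
  then show thesis
  proof cases
    case 1
    then have "i = j \<and> q = r" using P_eq[of i j q r] assms j by auto
    with 1 show thesis using that(1) by auto
  next
    case 2
    then have "i = j \<and> q = Suc r" using P_eq[of i j q "Suc r"] assms j by auto
    with 2 show thesis using that(2) by auto
  qed
qed

lemma neighbour_pole:
  assumes "{P i 0, v} \<in> E" "i < l"
  obtains j where "j < l" "v = P j 1" "edge j 0 = {P i 0, v}"
proof -
  obtain j r where j: "j < l" "r \<le> d j" "{P i 0, v} = edge j r"
    using assms(1) unfolding E_eq by auto
  then consider "P i 0 = P j r" "v = P j (Suc r)" | "P i 0 = P j (Suc r)" "v = P j r"
    by (auto simp: doubleton_eq_iff)
  then show thesis
  proof cases
    case 1
    then have "r = 0" using P_eq[of i j 0 r] assms j by auto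
    with 1 j show thesis using that by auto
  next
    case 2
    then show thesis using P_eq[of i j 0 "Suc r"] assms j by auto
  qed
qed

section \<open>Which removals keep the graph connected\<close>

lemma reachable_closed:
  assumes "(u, v) \<in> (adj F)\<^sup>*" "u \<in> X" "\<And>x y. x \<in> X \<Longrightarrow> {x, y} \<in> F \<Longrightarrow> y \<in> X"
  shows "v \<in> X"
  using assms by (induction rule: rtrancl_induct) (auto simp: adj_def)

text \<open>Two removed edges of one path would cut off the segment between them, which contains
  neither pole.\<close>

lemma admissible_one_per_path:
  assumes "admissible V E R" "i < l" "q \<le> d i" "r \<le> d i" "edge i q \<in> R" "edge i r \<in> R"
  shows "q = r"
proof -
  have False if qr: "q < r" "r \<le> d i" "edge i q \<in> R" "edge i r \<in> R" for q r
  proof -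
    define X where "X = {P i s | s. q < s \<and> s \<le> r}"
    have closed: "y \<in> X" if x: "x \<in> X" and xy: "{x, y} \<in> E - R" for x y
    proof -
      obtain s where s: "x = P i s" "q < s" "s \<le> r" using x by (auto simp: X_def)
      then have "{P i s, y} \<in> E" using xy by auto
      then show ?thesis
      proof (rule neighbour_inner)
        assume y: "y = P i (Suc s)" "edge i s = {P i s, y}"
        then have "edge i s \<notin> R" using xy s(1) by simp
        with qr have "s \<noteq> r" by metis
        with s y show ?thesis by (auto simp: X_def)
      next
        assume y: "y = P i (s - 1)" "edge i (s - 1) = {P i s, y}"
        then have "edge i (s - 1) \<notin> R" using xy s(1) by (metis DiffD2)
        with qr have "s - 1 \<noteq> q" by metis
        with s have "q < s - 1" "s - 1 \<le> r" by auto
        with y show ?thesis by (auto simp: X_def)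
      qed (use s qr assms in auto)
    qed
    have "(P i r, P i 0) \<in> (adj (E - R))\<^sup>*"
    proof -
      have "P i r \<in> V" "P i 0 \<in> V" unfolding V_eq using qr assms(2) le_SucI by blast+
      then show ?thesis using assms(1) unfolding admissible_def graph_connected_def by blast
    qed
    moreover have "P i r \<in> X" using qr by (auto simp: X_def)
    ultimately have "P i 0 \<in> X" using closed by (rule reachable_closed)
    then obtain s where "P i 0 = P i s" "q < s" "s \<le> r" by (auto simp: X_def)
    then show False using P_eq[of i i 0 s] qr(2) assms(2) by auto
  qed
  from this[of q r] this[of r q] show ?thesis using assms by fastforce
qed

text \<open>If every path lost an edge, the parts of the paths before these edges would form a
  closed set containing \<open>P 0 0\<close> but not the other pole.\<close>

lemma admissible_free_path:
  assumes "admissible V E R"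
  obtains j where "j < l" "\<And>q. q \<le> d j \<Longrightarrow> edge j q \<notin> R"
proof (rule ccontr)
  assume "\<not> thesis"
  with that have "\<forall>j. \<exists>q. j < l \<longrightarrow> q \<le> d j \<and> edge j q \<in> R" by metis
  then obtain c where c: "\<And>j. j < l \<Longrightarrow> c j \<le> d j \<and> edge j (c j) \<in> R" by metis
  define X where "X = {P i s | i s. i < l \<and> s \<le> c i}"
  have closed: "y \<in> X" if x: "x \<in> X" and xy: "{x, y} \<in> E - R" for x y
  proof -
    obtain i s where s: "x = P i s" "i < l" "s \<le> c i" using x by (auto simp: X_def)
    then have e: "{P i s, y} \<in> E" using xy by auto
    show ?thesis
    proof (cases "s = 0")
      case True
      with e have "{P i 0, y} \<in> E" by simp
      then obtain j where j: "j < l" "y = P j 1" "edge j 0 = {P i 0, y}"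
        using s(2) by (rule neighbour_pole)
      then have "edge j 0 \<notin> R" using xy s(1) True by simp
      with c[OF j(1)] have "c j \<noteq> 0" by metis
      with j show ?thesis by (fastforce simp: X_def)
    next
      case False
      from e show ?thesis
      proof (rule neighbour_inner)
        assume y: "y = P i (Suc s)" "edge i s = {P i s, y}"
        then have "edge i s \<notin> R" using xy s(1) by simp
        with c[OF s(2)] have "s \<noteq> c i" by metis
        with s y show ?thesis by (fastforce simp: X_def)
      next
        assume y: "y = P i (s - 1)"
        have "s - 1 \<le> c i" using s by simp
        with y s show ?thesis by (auto simp: X_def)
      qed (use False s c[of i] in auto)
    qed
  qed
  have "P 0 0 \<in> V" "P 0 (Suc (d 0)) \<in> V"
    using l_pos by (auto simp: V_eq)
  then have "(P 0 0, P 0 (Suc (d 0))) \<in> (adj (E - R))\<^sup>*"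
    using assms unfolding admissible_def graph_connected_def by blast
  moreover have "P 0 0 \<in> X" using l_pos by (auto simp: X_def)
  ultimately have "P 0 (Suc (d 0)) \<in> X" using closed by (rule reachable_closed)
  then obtain i s where "i < l" "s \<le> c i" "P 0 (Suc (d 0)) = P i s" by (auto simp: X_def)
  then show False using P_eq[of 0 i "Suc (d 0)" s] c[of i] l_pos by auto
qed

text \<open>After one cut per path each piece still hangs on a pole, and the intact path
  \<open>j\<close> joins the poles.\<close>

lemma admissible_cuts:
  assumes "j < l" "j \<notin> I" "I \<subseteq> {..<l}" "\<And>i. i \<in> I \<Longrightarrow> c i \<le> d i"
  shows "admissible V E {edge i (c i) | i. i \<in> I}"
proof -
  let ?R = "{edge i (c i) | i. i \<in> I}"
  let ?C = "(adj (E - ?R))\<^sup>*"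
  have sym: "(v, u) \<in> ?C" if "(u, v) \<in> ?C" for u v
  proof -
    have "sym (adj F)" for F :: "'v set set" by (auto simp: sym_def adj_def insert_commute)
    from symD[OF sym_rtrancl[OF this] that] show ?thesis .
  qed
  have present: "(P i q, P i (Suc q)) \<in> ?C"
    if i: "i < l" "q \<le> d i" and free: "i \<in> I \<Longrightarrow> q \<noteq> c i" for i q
  proof -
    have "edge i q \<noteq> edge m (c m)" if "m \<in> I" for m
    proof -
      have "m < l" "c m \<le> d m" using that assms(3,4) by auto
      from edge_eq[OF i(1) this(1) i(2) this(2)] show ?thesis using free that by blast
    qed
    then have "edge i q \<in> E - ?R" using edge_in_E[OF i] by blast
    moreover have "P i q \<noteq> P i (Suc q)" using i P_eq[of i i q "Suc q"] by simp
    ultimately show ?thesis unfolding adj_def by blast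
  qed
  \<comment> \<open>The last premise says that the cut edge, from index \<open>c i\<close> to
    \<open>c i + 1\<close>, is not among those between \<open>q\<close> and
    \<open>r\<close>.\<close>
  have chain: "(P i q, P i r) \<in> ?C"
    if "q \<le> r" "i < l" "r \<le> Suc (d i)" "i \<notin> I \<or> c i < q \<or> r \<le> c i" for i q r
    using that
  proof (induction r rule: dec_induct)
    case base
    show ?case by (rule rtrancl.rtrancl_refl)
  next
    case (step n)
    have "(P i q, P i n) \<in> ?C" using step by (intro step.IH) auto
    moreover have "(P i n, P i (Suc n)) \<in> ?C" using step.hyps step.prems by (intro present) auto
    ultimately show ?case by (rule rtrancl_trans)
  qed
  have poles: "(P 0 0, P i (Suc (d i))) \<in> ?C" if "i < l" for i
  proof -
    have "P j 0 = P 0 0" "P j (Suc (d j)) = P i (Suc (d i))"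
      using P_eq[of j 0 0 0] P_eq[of j i "Suc (d j)" "Suc (d i)"] assms(1) that l_pos by auto
    moreover have "(P j 0, P j (Suc (d j))) \<in> ?C" using assms(1,2) by (intro chain) auto
    ultimately show ?thesis by simp
  qed
  have reach: "(P 0 0, P i q) \<in> ?C" if "i < l" "q \<le> Suc (d i)" for i q
  proof (cases "i \<in> I \<and> c i < q")
    case True
    then have "(P i q, P i (Suc (d i))) \<in> ?C" using that by (intro chain) auto
    from rtrancl_trans[OF poles[OF that(1)] sym[OF this]] show ?thesis .
  next
    case False
    then have "(P i 0, P i q) \<in> ?C" using that by (intro chain) auto
    moreover have "P i 0 = P 0 0" using P_eq[of i 0 0 0] that l_pos by simp
    ultimately show ?thesis by simp
  qed
  have "graph_connected V (E - ?R)"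
    unfolding graph_connected_def
  proof (intro ballI)
    fix u v assume "u \<in> V" "v \<in> V"
    then have u: "(P 0 0, u) \<in> ?C" and v: "(P 0 0, v) \<in> ?C" unfolding V_eq using reach by auto
    from rtrancl_trans[OF sym[OF u] v] show "(u, v) \<in> ?C" .
  qed
  moreover have "?R \<subseteq> E" using assms(3,4) edge_in_E by blast
  ultimately show ?thesis by (simp add: admissible_def)
qed

end

section \<open>The adversary against fewer ignorant agents than paths\<close>

text \<open>The source can be cornered only by ignorant agents approaching from both sides. The adversary
  keeps one side, the segment from the pole \<open>P i 0\<close> up to the source, free of ignorant agents.\<close>

definition sheltered ::
    "nat \<Rightarrow> (nat \<Rightarrow> nat) \<Rightarrow> (nat \<Rightarrow> nat \<Rightarrow> 'v) \<Rightarrow> nat \<Rightarrow> (nat \<Rightarrow> 'v) \<Rightarrow> bool" where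
  "sheltered l d P k pos \<longleftrightarrow>
     (\<exists>i<l. \<exists>p\<le>d i. pos 0 = P i p \<and> (\<forall>a\<in>{1..k}. \<forall>q\<le>p. pos a \<noteq> P i q))"

context theta
begin

text \<open>The adversary cuts before seeing the move, so one removal must cope with every legal
  \<open>npos\<close>. Three cases: the source is at the pole; it is inside a path and some other
  path has no ignorant agent in its interior; all other paths are occupied. Only in the last can the
  free side switch to the other pole.\<close>

lemma sheltered_kept:
  assumes "k < l" and "sheltered l d P k pos"
  shows "\<exists>R. admissible V E R \<and>
    (\<forall>npos. (\<forall>a. npos a = pos a \<or> {pos a, npos a} \<in> E - R) \<longrightarrow>
       sheltered l d P k npos \<or> sheltered l d (\<lambda>i q. P i (Suc (d i) - q)) k npos)"
proof -
  obtain i p where i: "i < l" "p \<le> d i" "pos 0 = P i p"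
    and free: "\<And>a q. a \<in> {1..k} \<Longrightarrow> q \<le> p \<Longrightarrow> pos a \<noteq> P i q"
    using assms(2) unfolding sheltered_def by blast
  define occ where "occ j \<longleftrightarrow> (\<exists>a\<in>{1..k}. \<exists>q. 1 \<le> q \<and> q \<le> d j \<and> pos a = P j q)" for j
  have "\<forall>j. \<exists>a. occ j \<longrightarrow> a \<in> {1..k} \<and> (\<exists>q. 1 \<le> q \<and> q \<le> d j \<and> pos a = P j q)"
    unfolding occ_def by blast
  then obtain g where g: "\<And>j. occ j \<Longrightarrow> g j \<in> {1..k} \<and> (\<exists>q. 1 \<le> q \<and> q \<le> d j \<and> pos (g j) = P j q)"
    by metis
  \<comment> \<open>Interiors of distinct paths are disjoint, so occupied paths are counted by
    distinct ignorant agents.\<close>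
  have g_inj: "inj_on g {j. j < l \<and> occ j}"
  proof (rule inj_onI, clarify)
    fix j m assume j: "j < l" "occ j" "m < l" "occ m" "g j = g m"
    obtain q where q: "1 \<le> q" "q \<le> d j" "pos (g j) = P j q" using g[OF j(2)] by blast
    obtain r where r: "1 \<le> r" "r \<le> d m" "pos (g m) = P m r" using g[OF j(4)] by blast
    show "j = m" using P_eq[of j m q r] q r j by auto
  qed
  have pole_from: "\<exists>j<l. pos a = P j 1 \<and> edge j 0 \<notin> R"
    if "{pos a, v} \<in> E - R" "v = P m 0" "m < l" for a v m R
  proof -
    have e: "{P m 0, pos a} \<in> E" "{P m 0, pos a} \<notin> R" using that by (auto simp: insert_commute)
    from e(1) that(3) obtain j where "j < l" "pos a = P j 1" "edge j 0 = {P m 0, pos a}"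
      by (rule neighbour_pole)
    with e(2) show ?thesis by metis
  qed
  have inner_from: "(pos a = P m (Suc q) \<and> edge m q \<notin> R) \<or> pos a = P m (q - 1)"
    if "{pos a, v} \<in> E - R" "v = P m q" "m < l" "1 \<le> q" "q \<le> d m" for a v m q R
  proof -
    have e: "{P m q, pos a} \<in> E" "{P m q, pos a} \<notin> R" using that by (auto simp: insert_commute)
    from e(1) that(3-5) show ?thesis
      by (rule neighbour_inner) (use e(2) in metis)+
  qed
  show ?thesis
  proof (cases "p = 0")
    case True
    let ?J = "{j. j < l \<and> occ j}"
    \<comment> \<open>Occupied paths are cut at the pole, which keeps their agents out of it; the
      source can then only stay or step onto an unoccupied path.\<close>
    define R where "R = {edge j 0 | j. j \<in> ?J}"
    have R: "edge j 0 \<in> R" if "j < l" "occ j" for j using that unfolding R_def by blast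
    have "\<exists>j<l. \<not> occ j"
    proof (rule ccontr)
      assume "\<not> ?thesis"
      then have "?J = {..<l}" by auto
      then have "inj_on g {..<l}" "g ` {..<l} \<subseteq> {1..k}" using g_inj g by (simp, blast)
      then have "l \<le> k" using card_inj_on_le[of g "{..<l}" "{1..k}"] by simp
      then show False using assms(1) by simp
    qed
    then obtain j where "j < l" "\<not> occ j" by blast
    then have "admissible V E R" unfolding R_def by (intro admissible_cuts[of j]) auto
    moreover have "sheltered l d P k npos" if legal: "\<forall>a. npos a = pos a \<or> {pos a, npos a} \<in> E - R" for npos
    proof -
      have no_pole: "npos a \<noteq> P i 0" if a: "a \<in> {1..k}" for a
      proof
        assume v: "npos a = P i 0"
        then have "{pos a, npos a} \<in> E - R" using legal free[OF a, of 0] by (metis le0)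
        from pole_from[OF this v i(1)] obtain m where m: "m < l" "pos a = P m 1" "edge m 0 \<notin> R" by blast
        then have "occ m" using a d_ge[of m] unfolding occ_def by (intro bexI[of _ a] exI[of _ 1]) auto
        with m R show False by blast
      qed
      consider "npos 0 = P i 0" | "{P i 0, npos 0} \<in> E - R" using legal i True by metis
      then show ?thesis
      proof cases
        case 1
        then show ?thesis unfolding sheltered_def using i(1) no_pole by (intro exI[of _ i]) auto
      next
        case 2
        then have "{P i 0, npos 0} \<in> E" by simp
        then obtain m where m: "m < l" "npos 0 = P m 1" "edge m 0 = {P i 0, npos 0}"
          using i(1) by (rule neighbour_pole)
        have "edge m 0 \<notin> R" using 2 m(3) by (metis DiffD2)
        then have "\<not> occ m" using R[OF m(1)] by blast
        have pole: "P m 0 = P i 0" using P_eq[of m i 0 0] m(1) i(1) by simp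
        have "npos a \<noteq> P m q" if a: "a \<in> {1..k}" and q: "q \<le> 1" for a q
        proof (cases "q = 0")
          case True
          then show ?thesis using no_pole[OF a] pole by simp
        next
          case False
          then have [simp]: "q = 1" using q by simp
          \<comment> \<open>To be at \<open>P m 1\<close> after one round an agent must start at the
            pole, at \<open>P m 1\<close> or at \<open>P m 2\<close>. The last two are interior
            because \<open>d m\<close> is at least 2, and the path is unoccupied.\<close>
          have far: "pos a \<noteq> P m r" if "1 \<le> r" "r \<le> 2" for r
            using \<open>\<not> occ m\<close> a that d_ge[OF m(1)] unfolding occ_def by (meson order_trans)
          have "pos a \<noteq> P m 0" using pole free[OF a, of 0] by simp
          show ?thesis
          proof
            assume v: "npos a = P m q"
            then have "{pos a, npos a} \<in> E - R" using legal[rule_format, of a] far[of 1] by simp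
            from inner_from[OF this v m(1)] d_ge[OF m(1)] have "pos a = P m 2 \<or> pos a = P m 0"
              by (auto simp: numeral_2_eq_2)
            with far[of 2] \<open>pos a \<noteq> P m 0\<close> show False by auto
          qed
        qed
        then show ?thesis unfolding sheltered_def using m d_ge[of m]
          by (intro exI[of _ m] conjI exI[of _ 1]) auto
      qed
    qed
    ultimately show ?thesis by blast
  next
    case False
    have source: "npos 0 = P i p \<or> (npos 0 = P i (Suc p) \<and> edge i p \<notin> R) \<or> npos 0 = P i (p - 1)"
      if "\<forall>a. npos a = pos a \<or> {pos a, npos a} \<in> E - R" for npos R
    proof (cases "npos 0 = pos 0")
      case True
      then show ?thesis using i by simp
    next
      case neq: False
      then have e: "{P i p, npos 0} \<in> E" "{P i p, npos 0} \<notin> R" using that i(3) by (metis DiffD1 DiffD2)+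
      have "1 \<le> p" using False by simp
      from e(1) i(1) this i(2) show ?thesis by (rule neighbour_inner) (use e(2) in metis)+
    qed
    show ?thesis
    proof (cases "\<exists>j<l. j \<noteq> i \<and> \<not> occ j")
      case True
      then obtain j where j: "j < l" "j \<noteq> i" "\<not> occ j" by blast
      \<comment> \<open>Path \<open>i\<close> is cut directly ahead of the source and the others,
        except the unoccupied \<open>j\<close>, at the pole. In this round no ignorant agent can
        then enter the segment behind the source.\<close>
      let ?c = "\<lambda>m. if m = i then p else 0"
      define R where "R = {edge m (?c m) | m. m \<in> {..<l} - {j}}"
      have R: "edge m (?c m) \<in> R" if "m < l" "m \<noteq> j" for m using that unfolding R_def by blast
      have "admissible V E R" unfolding R_def using j(1) i(2) by (intro admissible_cuts[of j]) auto
      moreover have "sheltered l d P k npos"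
        if legal: "\<forall>a. npos a = pos a \<or> {pos a, npos a} \<in> E - R" for npos
      proof -
        have cut: "edge i p \<in> R" using R[of i] i(1) j(2) by simp
        have "npos a \<noteq> P i q" if a: "a \<in> {1..k}" and q: "q \<le> p" for a q
        proof
          assume v: "npos a = P i q"
          then have e: "{pos a, npos a} \<in> E - R" using legal free[OF a q] by metis
          show False
          proof (cases "q = 0")
            case True
            with pole_from[OF e] v i(1) obtain m where m: "m < l" "pos a = P m 1" "edge m 0 \<notin> R" by blast
            have "m = i \<or> m = j"
            proof (rule ccontr)
              assume "\<not> ?thesis"
              then have "edge m 0 \<in> R" using R[of m] m(1) by simp
              with m(3) show False by simp
            qed
            then show False
            proof
              assume "m = i"
              then show False using m(2) free[OF a, of 1] False by simp
            next
              assume "m = j"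
              moreover have "1 \<le> d j" using d_ge[OF j(1)] by simp
              ultimately show False using m(2) j(3) a unfolding occ_def by blast
            qed
          next
            case q0: False
            have "1 \<le> q" "q \<le> d i" using q0 q i(2) by auto
            from inner_from[OF e v i(1) this] show False
            proof
              assume *: "pos a = P i (Suc q) \<and> edge i q \<notin> R"
              then have "q \<noteq> p" using cut by metis
              then show False using * free[OF a, of "Suc q"] q by simp
            next
              assume "pos a = P i (q - 1)"
              moreover have "q - 1 \<le> p" using q by simp
              ultimately show False using free[OF a] by blast
            qed
          qed
        qed
        moreover have "npos 0 = P i p \<or> npos 0 = P i (p - 1)" using source[OF legal] cut by metis
        ultimately show ?thesis unfolding sheltered_def using i(1,2)
          by (metis (no_types, lifting) diff_le_self order_trans)
      qed
      ultimately show ?thesis by blast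
    next
      case all_occ: False
      let ?I = "{..<l} - {i}"
      have I: "?I \<subseteq> {j. j < l \<and> occ j}" using all_occ by auto
      have gI: "g ` ?I \<subseteq> {1..k}" using I g by blast
      \<comment> \<open>The other \<open>l - 1\<close> paths absorb \<open>l - 1\<close> distinct
        ignorant agents, and there are at most that many: each path has exactly one and nobody is
        elsewhere.\<close>
      have "card (g ` ?I) = l - 1"
        using inj_on_subset[OF g_inj I] i(1) by (simp add: card_image)
      then have g_img: "g ` ?I = {1..k}" using gI assms(1) by (intro card_seteq) auto
      have g_all: "\<exists>j<l. j \<noteq> i \<and> g j = a" if "a \<in> {1..k}" for a
      proof -
        have "a \<in> g ` ?I" using that g_img by simp
        then show ?thesis by auto
      qed
      \<comment> \<open>The single agent is confined by cutting the end it is adjacent to. As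
        \<open>d j\<close> is at least 2, it is never adjacent to both ends.\<close>
      let ?c = "\<lambda>j. if pos (g j) = P j 1 then 0 else d j"
      define R where "R = {edge j (?c j) | j. j \<in> ?I}"
      have R: "edge j (?c j) \<in> R" if "j < l" "j \<noteq> i" for j using that unfolding R_def by blast
      have "admissible V E R" unfolding R_def using i(1) by (intro admissible_cuts[of i]) auto
      moreover have "sheltered l d P k npos \<or> sheltered l d (\<lambda>i q. P i (Suc (d i) - q)) k npos"
        if legal: "\<forall>a. npos a = pos a \<or> {pos a, npos a} \<in> E - R" for npos
      proof -
        have inner: "\<exists>j<l. j \<noteq> i \<and> (\<exists>q. 1 \<le> q \<and> q \<le> d j \<and> npos a = P j q)" if a: "a \<in> {1..k}" for a
        proof -
          obtain j where j: "j < l" "j \<noteq> i" "g j = a" using g_all[OF a] by blast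
          then have "occ j" using I by blast
          then obtain q where q: "1 \<le> q" "q \<le> d j" "pos a = P j q" using g[of j] j by blast
          have cut: "edge j (?c j) \<in> R" using R j by blast
          have "\<exists>q. 1 \<le> q \<and> q \<le> d j \<and> npos a = P j q"
          proof (cases "npos a = pos a")
            case True
            then show ?thesis using q by auto
          next
            case False
            then have e: "{P j q, npos a} \<in> E" "{P j q, npos a} \<notin> R"
              using legal q(3) by (metis DiffD1 DiffD2)+
            from e(1) j(1) q(1,2) show ?thesis
            proof (rule neighbour_inner)
              assume v: "npos a = P j (Suc q)" "edge j q = {P j q, npos a}"
              have "q \<noteq> d j"
              proof
                assume "q = d j"
                then have "pos (g j) \<noteq> P j 1" using q j P_eq[of j j q 1] d_ge[of j] by auto
                then have "edge j q \<in> R" using cut \<open>q = d j\<close> by simp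
                then show False using e(2) v(2) by metis
              qed
              then show ?thesis using v q by (intro exI[of _ "Suc q"]) auto
            next
              assume v: "npos a = P j (q - 1)" "edge j (q - 1) = {P j q, npos a}"
              have "q \<noteq> 1"
              proof
                assume "q = 1"
                then have "edge j (q - 1) \<in> R" using cut q j by simp
                then show False using e(2) v(2) by metis
              qed
              then show ?thesis using v q by (intro exI[of _ "q - 1"]) auto
            qed
          qed
          then show ?thesis using j by blast
        qed
        have off: "npos a \<noteq> P i q" if a: "a \<in> {1..k}" and q: "q \<le> Suc (d i)" for a q
        proof -
          obtain j r where "j < l" "j \<noteq> i" "1 \<le> r" "r \<le> d j" "npos a = P j r" using inner[OF a] by blast
          then show ?thesis using P_eq[of j i r q] i(1) q by auto
        qed
        obtain s where s: "npos 0 = P i s" "s \<le> Suc (d i)"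
        proof -
          consider "npos 0 = P i p" | "npos 0 = P i (Suc p)" | "npos 0 = P i (p - 1)"
            using source[OF legal] by blast
          then show thesis
            by cases (use that[of p] that[of "Suc p"] that[of "p - 1"] i(2) in auto)
        qed
        show ?thesis
        proof (cases "s = Suc (d i)")
          case True
          \<comment> \<open>A source that has reached the far pole is at position 0 in the reversed
            numbering.\<close>
          have "sheltered l d (\<lambda>i q. P i (Suc (d i) - q)) k npos"
            unfolding sheltered_def using i(1) s True off
            by (intro exI[of _ i] conjI exI[of _ 0]) auto
          then show ?thesis ..
        next
          case False
          then have "sheltered l d P k npos"
            unfolding sheltered_def using i(1) s off
            by (intro exI[of _ i] conjI exI[of _ s]) auto
          then show ?thesis ..
        qed
      qed
      ultimately show ?thesis by blast
    qed
  qed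
qed

lemma not_solvable:
  assumes "1 \<le> k" "k < l"
  shows "\<not> broadcast_solvable V E k"
proof -
  let ?P' = "\<lambda>i q. P i (Suc (d i) - q)"
  \<comment> \<open>The source starts on a pole and the ignorant agents next to it on different
    paths, so the segment consisting of that pole alone is free.\<close>
  define p where "p a = (if a = 0 then P 0 0 else P (a - 1) 1)" for a
  define Inv where
    "Inv c \<longleftrightarrow> snd c = {0} \<and> (sheltered l d P k (fst c) \<or> sheltered l d ?P' k (fst c))"
    for c :: "'v conf"
  interpret rev: theta l d ?P' V E by (rule reversed)
  \<comment> \<open>Reversing twice is the identity on indices up to \<open>Suc (d i)\<close>, the
    only ones that \<open>sheltered\<close> inspects.\<close>
  have twice: "sheltered l d (\<lambda>i q. P i (Suc (d i) - (Suc (d i) - q))) k pos \<longleftrightarrow> sheltered l d P k pos" for pos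
    unfolding sheltered_def
    by (intro ex_cong1 conj_cong refl ball_cong all_cong1 imp_cong) auto
  show ?thesis
  proof (rule not_broadcast_solvableI[where p = p and Inv = Inv])
    show "inj_on p {0..k}"
    proof (rule inj_onI)
      fix a b assume ab: "a \<in> {0..k}" "b \<in> {0..k}" "p a = p b"
      then have "a - 1 < l" "b - 1 < l" using assms by auto
      then show "a = b"
        using ab P_eq[of 0 "b - 1" 0 1] P_eq[of "a - 1" 0 1 0] P_eq[of "a - 1" "b - 1" 1 1]
          d_ge[of "a - 1"] l_pos
        by (auto simp: p_def split: if_splits)
    qed
    show "p ` {0..k} \<subseteq> V"
    proof
      fix v assume "v \<in> p ` {0..k}"
      then obtain a where a: "a \<le> k" "v = p a" by auto
      show "v \<in> V"
      proof (cases "a = 0")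
        case True
        then show ?thesis unfolding V_eq using a l_pos by (auto simp: p_def)
      next
        case False
        then have "a - 1 < l" "v = P (a - 1) 1" using a assms by (auto simp: p_def)
        then show ?thesis unfolding V_eq by auto
      qed
    qed
    have "p a \<noteq> P 0 0" if "a \<in> {1..k}" for a
    proof -
      have "a - 1 < l" "p a = P (a - 1) 1" using that assms by (auto simp: p_def)
      then show ?thesis using P_eq[of "a - 1" 0 1 0] l_pos by simp
    qed
    then have "sheltered l d P k p"
      unfolding sheltered_def using l_pos by (intro exI[of _ 0]) (auto simp: p_def)
    then show "Inv (p, {0})" by (simp add: Inv_def)
  next
    fix c assume "Inv c"
    then have c: "snd c = {0}" "sheltered l d P k (fst c) \<or> sheltered l d ?P' k (fst c)"
      by (auto simp: Inv_def)
    have "\<exists>R. admissible V E R \<and>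
      (\<forall>npos. (\<forall>a. npos a = fst c a \<or> {fst c a, npos a} \<in> E - R) \<longrightarrow>
         sheltered l d P k npos \<or> sheltered l d ?P' k npos)"
      using c(2)
    proof
      assume "sheltered l d P k (fst c)"
      from sheltered_kept[OF assms(2) this] show ?thesis .
    next
      assume "sheltered l d ?P' k (fst c)"
      from rev.sheltered_kept[OF assms(2) this] show ?thesis unfolding twice by blast
    qed
    then obtain R where R: "admissible V E R"
      and kept: "\<And>npos. (\<And>a. npos a = fst c a \<or> {fst c a, npos a} \<in> E - R) \<Longrightarrow>
         sheltered l d P k npos \<or> sheltered l d ?P' k npos"
      by blast
    have "Inv (step k (E - R) c tgt)" for tgt
    proof -
      define npos where "npos = fst (step k (E - R) c tgt)"
      have npos: "sheltered l d P k npos \<or> sheltered l d ?P' k npos"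
        by (rule kept) (simp add: npos_def step_def Let_def)
      then have "npos a \<noteq> npos 0" if "a \<in> {1..k}" for a
        using that unfolding sheltered_def by force
      then have "a = 0" if "a \<le> k" "npos 0 = npos a" for a
        using that by (metis One_nat_def Suc_leI atLeastAtMost_iff gr0I)
      moreover have "snd (step k (E - R) c tgt) = {0} \<union> {a. a \<le> k \<and> npos 0 = npos a}"
        using c(1) by (simp add: npos_def step_def Let_def)
      ultimately have "snd (step k (E - R) c tgt) = {0}" by auto
      with npos show ?thesis by (simp add: Inv_def npos_def)
    qed
    with R show "\<exists>R. admissible V E R \<and> (\<forall>tgt. Inv (step k (E - R) c tgt))" by blast
  next
    fix c assume "Inv c"
    then show "\<not> {0..k} \<subseteq> snd c" using assms(1) by (auto simp: Inv_def)
  qed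
qed

end

section \<open>The agents against the adversary\<close>

text \<open>For a fixed informed set, the agents are coloured by \<open>C\<close> and its complement, and \<open>good pos\<close> says
  that they can force two agents of different colours to meet. The assumptions do not distinguish
  the two colours, and moving a single agent per round suffices.\<close>

locale pursuit = theta l d P V E
  for l :: nat and d :: "nat \<Rightarrow> nat" and P :: "nat \<Rightarrow> nat \<Rightarrow> 'v" and V :: "'v set" and E :: "'v set set" +
  fixes A C :: "nat set" and good :: "(nat \<Rightarrow> 'v) \<Rightarrow> bool"
  assumes finite_A: "finite A" and card_A: "l < card A"
    and C_subset: "C \<subseteq> A" and C_nonempty: "C \<noteq> {}" and C_proper: "A - C \<noteq> {}"
    and meet: "\<And>pos a b. \<lbrakk>a \<in> C; b \<in> A - C; pos a = pos b\<rbrakk> \<Longrightarrow> good pos"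
    and force: "\<And>pos. \<lbrakk>pos ` A \<subseteq> V;
      \<And>R. admissible V E R \<Longrightarrow> \<exists>a\<in>A. \<exists>v. {pos a, v} \<in> E - R \<and> good (pos(a := v))\<rbrakk> \<Longrightarrow> good pos"
begin

lemma reversed_pursuit: "pursuit l d (\<lambda>i q. P i (Suc (d i) - q)) V E A C good"
proof -
  interpret rev: theta l d "\<lambda>i q. P i (Suc (d i) - q)" V E by (rule reversed)
  show ?thesis
    by unfold_locales (use finite_A card_A C_subset C_nonempty C_proper meet force in blast)+
qed

text \<open>\<open>meet\<close> is symmetric in the two colours and \<open>force\<close> ignores
  them, so each result about an agent in \<open>C\<close> also holds for one outside.\<close>

lemma recoloured_pursuit: "pursuit l d P V E A (A - C) good"
proof
  show "good pos" if "a \<in> A - C" "b \<in> A - (A - C)" "pos a = pos b" for pos a b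
    using that meet[of b a pos] by auto
qed (use finite_A card_A C_subset C_nonempty C_proper force in blast)+

section \<open>Forcing a meeting by enclosing an agent\<close>

lemma edge_up: "\<lbrakk>i < l; q \<le> d i; pos a = P i q; edge i q \<notin> R\<rbrakk> \<Longrightarrow> {pos a, P i (Suc q)} \<in> E - R"
  using edge_in_E[of i q] by simp

lemma edge_down:
  assumes "i < l" "1 \<le> q" "q \<le> Suc (d i)" "pos a = P i q" "edge i (q - 1) \<notin> R"
  shows "{pos a, P i (q - 1)} \<in> E - R"
proof -
  have "{pos a, P i (q - 1)} = edge i (q - 1)" using assms by (simp add: insert_commute)
  then show ?thesis using edge_in_E[of i "q - 1"] assms by simp
qed

lemma moved_in_V: "pos ` A \<subseteq> V \<Longrightarrow> {pos a, v} \<in> E - R \<Longrightarrow> (pos(a := v)) ` A \<subseteq> V"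
  using edge_subset_V[of "{pos a, v}"] by auto

lemma sandwich:
  assumes "pos ` A \<subseteq> V" "i < l" "x \<in> C" "y \<in> C" "z \<in> A - C"
    and "pos x = P i p" "pos z = P i q" "pos y = P i r" "p \<le> q" "q \<le> r" "r \<le> Suc (d i)"
  shows "good pos"
  using assms
proof (induction "r - p" arbitrary: pos p r rule: less_induct)
  case less
  show ?case
  proof (cases "p = q \<or> q = r")
    case True
    then have "pos x = pos z \<or> pos y = pos z" using less.prems by auto
    then show ?thesis using meet less.prems(3-5) by blast
  next
    case False
    then have pqr: "p < q" "q < r" using less.prems by auto
    then have "P i p \<noteq> P i r" using P_eq[of i i p r] less.prems by auto
    then have neq: "x \<noteq> y" "z \<noteq> x" "z \<noteq> y" using less.prems by auto
    have A: "x \<in> A" "y \<in> A" using less.prems C_subset by auto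
    show ?thesis
    proof (rule force[OF less.prems(1)])
      fix R assume R: "admissible V E R"
      have le: "p \<le> d i" "r - 1 \<le> d i" "p \<noteq> r - 1" using pqr less.prems by auto
      then have "edge i p \<notin> R \<or> edge i (r - 1) \<notin> R"
        using admissible_one_per_path[OF R less.prems(2) le(1,2)] by blast
      then show "\<exists>a\<in>A. \<exists>v. {pos a, v} \<in> E - R \<and> good (pos(a := v))"
      proof
        assume free: "edge i p \<notin> R"
        have e: "{pos x, P i (Suc p)} \<in> E - R" using free less.prems le by (intro edge_up) auto
        have "good (pos(x := P i (Suc p)))"
          by (rule less.hyps[of r "Suc p"])
            (use pqr less.prems neq moved_in_V[OF less.prems(1) e] in auto)
        with e A show ?thesis by blast
      next
        assume free: "edge i (r - 1) \<notin> R"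
        have e: "{pos y, P i (r - 1)} \<in> E - R" using free pqr less.prems le by (intro edge_down) auto
        have "good (pos(y := P i (r - 1)))"
          by (rule less.hyps[of "r - 1" p])
            (use pqr less.prems neq moved_in_V[OF less.prems(1) e] in auto)
        with e A show ?thesis by blast
      qed
    qed
  qed
qed

text \<open>Whatever path an agent of the other colour is on, the agents at the two poles enclose
  it.\<close>

lemma both_poles:
  assumes "pos ` A \<subseteq> V" "x \<in> C" "y \<in> C" "pos x = P 0 0" "i < l" "pos y = P i (Suc (d i))"
  shows "good pos"
proof -
  obtain z where z: "z \<in> A - C" using C_proper by blast
  then have "pos z \<in> V" using assms(1) by blast
  then obtain j q where j: "j < l" "q \<le> Suc (d j)" "pos z = P j q" unfolding V_eq by blast
  have "pos x = P j 0" "pos y = P j (Suc (d j))"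
    using P_eq[of 0 j 0 0] P_eq[of i j "Suc (d i)" "Suc (d j)"] assms j(1) l_pos by auto
  then show ?thesis using sandwich[OF assms(1) j(1) assms(2,3) z _ j(3)] j(2) by blast
qed

section \<open>Play with an agent waiting at a pole\<close>

definition coord :: "'v \<Rightarrow> nat \<times> nat" where
  "coord v = (SOME c. fst c < l \<and> snd c \<le> Suc (d (fst c)) \<and> v = P (fst c) (snd c))"

text \<open>A pole has coordinates on every path and \<open>coord\<close> picks one arbitrarily.
  Thus \<open>height\<close>, the distance to \<open>P 0 0\<close> along the path, is meaningful
  except at the far pole, and \<open>depth\<close>, the distance to the far pole, except at
  \<open>P 0 0\<close>.\<close>

definition height :: "'v \<Rightarrow> nat" where "height v = snd (coord v)"

definition depth :: "'v \<Rightarrow> nat" where "depth v = Suc (d (fst (coord v))) - snd (coord v)"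

lemma coord_P:
  assumes "i < l" "q \<le> Suc (d i)"
  shows "fst (coord (P i q)) < l" "snd (coord (P i q)) \<le> Suc (d (fst (coord (P i q))))"
    "P i q = P (fst (coord (P i q))) (snd (coord (P i q)))"
proof -
  have "\<exists>c. fst c < l \<and> snd c \<le> Suc (d (fst c)) \<and> P i q = P (fst c) (snd c)"
    using assms by (intro exI[of _ "(i, q)"]) simp
  from someI_ex[OF this] show "fst (coord (P i q)) < l"
    "snd (coord (P i q)) \<le> Suc (d (fst (coord (P i q))))"
    "P i q = P (fst (coord (P i q))) (snd (coord (P i q)))"
    unfolding coord_def by blast+
qed

lemma height_P: "i < l \<Longrightarrow> q \<le> d i \<Longrightarrow> height (P i q) = q"
  using coord_P[of i q] P_eq[of i "fst (coord (P i q))" q "snd (coord (P i q))"]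
  unfolding height_def by auto

lemma depth_P: "i < l \<Longrightarrow> 1 \<le> q \<Longrightarrow> q \<le> Suc (d i) \<Longrightarrow> depth (P i q) = Suc (d i) - q"
  using coord_P[of i q] P_eq[of i "fst (coord (P i q))" q "snd (coord (P i q))"]
  unfolding depth_def by auto

definition inner :: "nat \<Rightarrow> nat \<Rightarrow> bool" where
  "inner i q \<longleftrightarrow> i < l \<and> 1 \<le> q \<and> q \<le> d i"

lemma height_inner: "inner i q \<Longrightarrow> height (P i q) = q"
  and depth_inner: "inner i q \<Longrightarrow> depth (P i q) = Suc (d i) - q"
  by (auto simp: inner_def height_P depth_P)

lemma inner_unique: "inner i q \<Longrightarrow> inner j r \<Longrightarrow> P i q = P j r \<longleftrightarrow> i = j \<and> q = r"
  unfolding inner_def by (subst P_eq) auto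

text \<open>The sum serves as a common upper bound for all \<open>d i\<close>.\<close>

abbreviation dmax :: nat where "dmax \<equiv> \<Sum>i<l. d i"

lemma d_le_dmax: "i < l \<Longrightarrow> d i \<le> dmax"
  by (intro member_le_sum) auto

text \<open>With an agent \<open>x\<close> of \<open>C\<close> waiting at \<open>P 0 0\<close>, every path gets at most one leader (the set \<open>L\<close>,
  with path assignment \<open>ln\<close>). Leaders of \<open>C\<close> head for the far pole, where they would sandwich the
  other colour; leaders of the other colour head for \<open>x\<close>. All other agents return to the pole
  from which they can enter a new path as leaders.\<close>

definition forward :: "nat set \<Rightarrow> nat \<Rightarrow> bool" where
  "forward L a \<longleftrightarrow> (a \<in> C \<longleftrightarrow> a \<in> L)"

text \<open>The second summand is the distance to the pole the agent heads for. The offset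
  \<open>Suc dmax\<close> makes promotion to leader profitable at every interior node.\<close>

definition weight :: "nat set \<Rightarrow> (nat \<Rightarrow> 'v) \<Rightarrow> nat \<Rightarrow> nat" where
  "weight L pos a = (if a \<in> L then 0 else Suc dmax) +
     (if forward L a then depth (pos a) else height (pos a))"

definition leaders :: "nat \<Rightarrow> nat set \<Rightarrow> (nat \<Rightarrow> nat) \<Rightarrow> (nat \<Rightarrow> 'v) \<Rightarrow> bool" where
  "leaders x L ln pos \<longleftrightarrow> L \<subseteq> A - {x} \<and> inj_on ln L \<and>
     (\<forall>a\<in>L. \<exists>q. inner (ln a) q \<and> pos a = P (ln a) q)"

lemma weight_leader_le:
  assumes "a \<in> L" "inner i q" "pos a = P i q"
  shows "weight L pos a \<le> dmax"
proof -
  have "q \<le> d i" "1 \<le> q" "d i \<le> dmax" using assms(2) d_le_dmax[of i] by (auto simp: inner_def)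
  then show ?thesis using assms by (auto simp: weight_def height_inner depth_inner)
qed

lemma sum_less_at:
  fixes f g :: "nat \<Rightarrow> nat"
  assumes "finite S" "a \<in> S" "f a < g a" "\<And>b. b \<in> S \<Longrightarrow> b \<noteq> a \<Longrightarrow> f b = g b"
  shows "sum f S < sum g S"
  using assms by (intro sum_strict_mono_ex1) (auto simp: le_less)

text \<open>Induction on the total weight of the agents other than \<open>x\<close>. If the position
  were not \<open>good\<close>, no regrouping of leaders could lower the weight
  (\<open>promote\<close>, \<open>order\<close>); yet against every removal some agent has a free
  edge along which it makes progress (\<open>advance\<close>, \<open>enter\<close>).\<close>

lemma pole_in_C_good:
  assumes x: "x \<in> C"
  shows "\<lbrakk>pos ` A \<subseteq> V; pos x = P 0 0; leaders x L ln pos\<rbrakk> \<Longrightarrow> good pos"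
proof (induction "\<Sum>a\<in>A - {x}. weight L pos a" arbitrary: pos L ln rule: less_induct)
  case less
  note posV = less.prems(1) and posx = less.prems(2)
  have L: "L \<subseteq> A - {x}" and ln: "inj_on ln L"
    and lead: "\<And>a. a \<in> L \<Longrightarrow> \<exists>q. inner (ln a) q \<and> pos a = P (ln a) q"
    using less.prems(3) unfolding leaders_def by auto
  have fin: "finite (A - {x})" using finite_A by simp
  show ?case
  proof (rule ccontr)
    assume bad: "\<not> good pos"
    have sep: "pos a \<noteq> pos b" if "a \<in> C" "b \<in> A - C" for a b
      using bad meet that by blast
    \<comment> \<open>An agent of the other colour on \<open>P 0 0\<close> would have met
      \<open>x\<close>; one of \<open>C\<close> on the far pole would win by
      \<open>both_poles\<close>.\<close>
    have place: "(\<exists>i q. inner i q \<and> pos a = P i q) \<or> (a \<in> C \<and> pos a = P 0 0) \<or>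
        (a \<notin> C \<and> pos a = P 0 (Suc (d 0)))" if "a \<in> A" for a
    proof -
      have "pos a \<in> V" using posV that by blast
      then obtain i q where i: "i < l" "q \<le> Suc (d i)" "pos a = P i q" unfolding V_eq by blast
      consider "inner i q" | "q = 0" | "q = Suc (d i)" using i by (force simp: inner_def)
      then show ?thesis
      proof cases
        case 1
        then show ?thesis using i by blast
      next
        case 2
        then have "pos a = P 0 0" using i P_eq[of i 0 0 0] l_pos by simp
        then show ?thesis using sep[OF x, of a] posx that by auto
      next
        case 3
        then have "pos a = P 0 (Suc (d 0))" using i P_eq[of i 0 q "Suc (d 0)"] l_pos by simp
        then show ?thesis using both_poles[OF posV x _ posx l_pos, of a] bad by blast
      qed
    qed
    have promote: "i \<in> ln ` L" if a: "a \<in> A - {x}" "a \<notin> L" "inner i q" "pos a = P i q" for a i q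
    proof (rule ccontr)
      assume i: "i \<notin> ln ` L"
      have "leaders x (insert a L) (ln(a := i)) pos"
        unfolding leaders_def using L ln lead a i by (auto simp: inj_on_def)
      moreover have "(\<Sum>b\<in>A - {x}. weight (insert a L) pos b) < (\<Sum>b\<in>A - {x}. weight L pos b)"
      proof (rule sum_less_at[OF fin a(1)])
        show "weight (insert a L) pos a < weight L pos a"
          using weight_leader_le[of a "insert a L" i q pos] a by (auto simp: weight_def)
      qed (auto simp: weight_def forward_def)
      ultimately show False using less.hyps posV posx bad by blast
    qed
    \<comment> \<open>Exchanging the roles of a leader and a non-leader of the same colour lowers
      the weight unless the leader is at least as far in its own direction. So ordered, the two move
      apart and never need the same edge.\<close>
    have order: "if a \<in> C then r \<le> q else q \<le> r"
      if a: "a \<in> L" and b: "b \<in> A - {x}" "b \<notin> L" and col: "a \<in> C \<longleftrightarrow> b \<in> C"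
        and iq: "inner i q" "pos a = P i q" and ir: "inner i r" "pos b = P i r" for a b i q r
    proof (rule ccontr)
      assume wrong: "\<not> ?thesis"
      let ?L = "insert b (L - {a})"
      have ab: "a \<noteq> b" using a b by blast
      have "ln a = i" using lead[OF a] iq inner_unique by auto
      then have "leaders x ?L (ln(b := i)) pos"
        unfolding leaders_def using L ln lead a b ir by (auto simp: inj_on_def)
      moreover have "(\<Sum>c\<in>A - {x}. weight ?L pos c) < (\<Sum>c\<in>A - {x}. weight L pos c)"
      proof -
        have split: "(\<Sum>c\<in>A - {x}. f c) = f a + (f b + (\<Sum>c\<in>A - {x} - {a} - {b}. f c))" for f :: "nat \<Rightarrow> nat"
          using fin a b ab L by (subst sum.remove[of _ a]; force simp: sum.remove[of _ b])
        have "(\<Sum>c\<in>A - {x} - {a} - {b}. weight ?L pos c) = (\<Sum>c\<in>A - {x} - {a} - {b}. weight L pos c)"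
          by (rule sum.cong) (auto simp: weight_def forward_def)
        moreover have "weight ?L pos a + weight ?L pos b < weight L pos a + weight L pos b"
          using wrong a b ab col iq ir
          by (auto simp: weight_def forward_def height_inner depth_inner inner_def split: if_splits)
        ultimately show ?thesis unfolding split by linarith
      qed
      ultimately show False using less.hyps posV posx bad by blast
    qed
    have advance: "\<exists>a\<in>A. \<exists>v. {pos a, v} \<in> E - R \<and> good (pos(a := v))"
      if a: "a \<in> A - {x}" and iq: "inner i q" "pos a = P i q"
        and free: "edge i (if forward L a then q else q - 1) \<notin> R" for R a i q
    proof -
      define r where "r = (if forward L a then Suc q else q - 1)"
      define pos' where "pos' = pos(a := P i r)"
      have i: "i < l" "1 \<le> q" "q \<le> d i" using iq by (auto simp: inner_def)
      have e: "{pos a, P i r} \<in> E - R"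
      proof (cases "forward L a")
        case True
        then show ?thesis using edge_up[of i q pos a R] i iq free by (simp add: r_def)
      next
        case False
        then show ?thesis using edge_down[of i q pos a R] i iq free by (simp add: r_def)
      qed
      have V': "pos' ` A \<subseteq> V" unfolding pos'_def by (rule moved_in_V[OF posV e])
      have x': "pos' x = P 0 0" using a posx by (simp add: pos'_def)
      have a': "pos' a = P i r" by (simp add: pos'_def)
      have less': "(\<Sum>b\<in>A - {x}. weight L pos' b) < (\<Sum>b\<in>A - {x}. weight L pos b)"
      proof (rule sum_less_at[OF fin a])
        show "weight L pos' a < weight L pos a"
          using i iq by (auto simp: weight_def a' r_def height_P depth_P)
        show "weight L pos' b = weight L pos b" if "b \<noteq> a" for b
          using that by (simp add: weight_def pos'_def)
      qed
      have "good pos'"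
      proof (cases "inner i r \<or> a \<notin> L")
        case True
        have "\<exists>s. inner (ln b) s \<and> pos' b = P (ln b) s" if b: "b \<in> L" for b
        proof (cases "b = a")
          case True
          then have "ln b = i" using lead[OF b] iq inner_unique by auto
          then show ?thesis using \<open>inner i r \<or> a \<notin> L\<close> True b a' by auto
        next
          case False
          then show ?thesis using lead[OF b] by (simp add: pos'_def)
        qed
        then have "leaders x L ln pos'" unfolding leaders_def using L ln by blast
        then show ?thesis using less.hyps[OF less' V' x'] by blast
      next
        case False
        \<comment> \<open>A leader that leaves the interior ends the play: one of \<open>C\<close>
          occupies the pole opposite \<open>x\<close>, one of the other colour runs into
          \<open>x\<close>.\<close>
        then have aL: "a \<in> L" and nr: "\<not> inner i r" by auto
        show ?thesis
        proof (cases "a \<in> C")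
          case True
          then have "r = Suc (d i)" using aL nr i by (auto simp: r_def forward_def inner_def)
          then show ?thesis using both_poles[OF V' x True x' i(1)] a' by simp
        next
          case False
          then have "r = 0" using aL nr i by (auto simp: r_def forward_def inner_def)
          then have "pos' x = pos' a" using x' a' P_eq[of i 0 0 0] i(1) l_pos by simp
          then show ?thesis using meet[OF x, of a] a False by blast
        qed
      qed
      then show ?thesis using e a unfolding pos'_def by blast
    qed
    have "good pos"
    proof (rule force[OF posV])
      fix R assume R: "admissible V E R"
      then obtain j where j: "j < l" and free: "\<And>q. q \<le> d j \<Longrightarrow> edge j q \<notin> R"
        by (rule admissible_free_path) blast
      show "\<exists>a\<in>A. \<exists>v. {pos a, v} \<in> E - R \<and> good (pos(a := v))"
      proof (cases "j \<in> ln ` L")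
        case True
        then obtain a q where a: "a \<in> L" "inner j q" "pos a = P j q" using lead by blast
        have "(if forward L a then q else q - 1) \<le> d j" using a(2) by (auto simp: inner_def)
        then show ?thesis using advance[OF _ a(2,3) free] a(1) L by blast
      next
        case False
        \<comment> \<open>Leaders occupy distinct paths other than \<open>j\<close>, so there are at
          most \<open>l - 1\<close>, while at least \<open>l\<close> agents besides \<open>x\<close>
          exist: someone is not a leader.\<close>
        have "ln ` L \<subseteq> {..<l} - {j}" using lead False by (auto simp: inner_def)
        then have "card (ln ` L) \<le> card ({..<l} - {j})" by (intro card_mono) auto
        then have "card L \<le> l - 1" using j by (simp add: card_image[OF ln])
        moreover have "card (A - {x}) \<ge> l" using card_A x C_subset by (subst card_Diff_singleton) auto
        ultimately have "card L < card (A - {x})" using l_pos by linarith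
        then have "\<not> A - {x} \<subseteq> L" using card_mono[of L "A - {x}"] finite_subset[OF L fin] by auto
        then obtain b where b: "b \<in> A - {x}" "b \<notin> L" by blast
        \<comment> \<open>From a pole, \<open>b\<close> can step onto the intact path
          \<open>j\<close> and become the leader it lacks.\<close>
        have enter: ?thesis if jr: "inner j r" and e: "{pos b, P j r} \<in> E - R" for r
        proof -
          define pos' where "pos' = pos(b := P j r)"
          have "leaders x (insert b L) (ln(b := j)) pos'"
            unfolding leaders_def using L ln lead b False jr by (auto simp: inj_on_def pos'_def)
          moreover have "(\<Sum>c\<in>A - {x}. weight (insert b L) pos' c) < (\<Sum>c\<in>A - {x}. weight L pos c)"
          proof (rule sum_less_at[OF fin b(1)])
            show "weight (insert b L) pos' b < weight L pos b"
              using weight_leader_le[of b "insert b L" j r pos'] b jr by (auto simp: weight_def pos'_def)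
          qed (auto simp: weight_def forward_def pos'_def)
          moreover have "pos' ` A \<subseteq> V" unfolding pos'_def by (rule moved_in_V[OF posV e])
          moreover have "pos' x = P 0 0" using b posx by (simp add: pos'_def)
          ultimately have "good pos'" using less.hyps by blast
          then show ?thesis using e b unfolding pos'_def by blast
        qed
        have "b \<in> A" using b by blast
        from place[OF this] consider
          (inside) i q where "inner i q" "pos b = P i q"
          | (near) "pos b = P 0 0" | (far) "pos b = P 0 (Suc (d 0))" by blast
        then show ?thesis
        proof cases
          case near
          then have "pos b = P j 0" using P_eq[of 0 j 0 0] j l_pos by simp
          then have "{pos b, P j (Suc 0)} \<in> E - R" using j free by (intro edge_up) auto
          moreover have "inner j (Suc 0)" using j d_ge[of j] by (simp add: inner_def)
          ultimately show ?thesis by (intro enter)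
        next
          case far
          then have "pos b = P j (Suc (d j))" using P_eq[of 0 j "Suc (d 0)" "Suc (d j)"] j l_pos by simp
          then have "{pos b, P j (Suc (d j) - 1)} \<in> E - R" using j free by (intro edge_down) auto
          moreover have "inner j (Suc (d j) - 1)" using j d_ge[of j] by (simp add: inner_def)
          ultimately show ?thesis by (intro enter)
        next
          case inside
          then obtain a where a: "a \<in> L" "ln a = i" using promote[OF b] by blast
          then obtain r where r: "inner i r" "pos a = P i r" using lead by blast
          let ?s = "if forward L a then r else r - 1" and ?t = "if forward L b then q else q - 1"
          have i: "i < l" "?s \<le> d i" "?t \<le> d i" using r inside by (auto simp: inner_def)
          have aA: "a \<in> A - {x}" using a L by blast
          \<comment> \<open>With equal colours the leader and \<open>b\<close> move apart; with
            different colours they move the same way from distinct nodes. Either way they need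
            different edges of path \<open>i\<close>, of which at most one is missing.\<close>
          have "?s \<noteq> ?t"
          proof (cases "a \<in> C \<longleftrightarrow> b \<in> C")
            case True
            then show ?thesis using order[OF a(1) b True r inside] a b r(1) inside(1)
              by (auto simp: forward_def inner_def split: if_splits)
          next
            case False
            then have "pos a \<noteq> pos b" using sep[of a b] sep[of b a] aA b by auto
            then have "r \<noteq> q" using r inside by auto
            then show ?thesis using False a b r(1) inside(1)
              by (auto simp: forward_def inner_def split: if_splits)
          qed
          then have "edge i ?s \<notin> R \<or> edge i ?t \<notin> R"
            using admissible_one_per_path[OF R i(1) i(2) i(3)] by blast
          then show ?thesis using advance[OF aA r] advance[OF b(1) inside] by blast
        qed
      qed
    qed
    with bad show False ..
  qed
qed

section \<open>Bringing some agent to a pole\<close>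

lemma pole_good:
  assumes "pos ` A \<subseteq> V" "a \<in> A" "i < l" "pos a = P i 0"
  shows "good pos"
proof -
  have a: "pos a = P 0 0" using assms P_eq[of i 0 0 0] l_pos by simp
  show ?thesis
  proof (cases "a \<in> C")
    case True
    \<comment> \<open>No leaders are needed at the start; they are recruited during the
      play.\<close>
    have "leaders a {} id pos" by (simp add: leaders_def)
    from pole_in_C_good[OF True assms(1) a this] show ?thesis .
  next
    case False
    interpret co: pursuit l d P V E A "A - C" good by (rule recoloured_pursuit)
    have "co.leaders a {} id pos" by (simp add: co.leaders_def)
    from co.pole_in_C_good[OF _ assms(1) a this] False assms(2) show ?thesis by blast
  qed
qed

lemma far_pole_good:
  assumes "pos ` A \<subseteq> V" "a \<in> A" "i < l" "pos a = P i (Suc (d i))"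
  shows "good pos"
proof -
  interpret rev: pursuit l d "\<lambda>i q. P i (Suc (d i) - q)" V E A C good by (rule reversed_pursuit)
  show ?thesis using assms by (intro rev.pole_good) auto
qed

text \<open>Colours do not matter here: the two agents walk apart, their outward edges are different
  edges of one path, so in each round one of them gets closer to its pole.\<close>

lemma two_on_path_good:
  assumes "pos ` A \<subseteq> V" "x \<in> A" "y \<in> A" "x \<noteq> y" "i < l"
    and "pos x = P i p" "pos y = P i q" "p \<le> q" "q \<le> Suc (d i)"
  shows "good pos"
  using assms
proof (induction "p + (Suc (d i) - q)" arbitrary: pos p q rule: less_induct)
  case less
  show ?case
  proof (cases "p = 0 \<or> q = Suc (d i)")
    case True
    then show ?thesis using pole_good far_pole_good less.prems by blast
  next
    case False
    show ?thesis
    proof (rule force[OF less.prems(1)])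
      fix R assume R: "admissible V E R"
      have le: "p - 1 \<le> d i" "q \<le> d i" "p - 1 \<noteq> q" using False less.prems by auto
      then have "edge i (p - 1) \<notin> R \<or> edge i q \<notin> R"
        using admissible_one_per_path[OF R less.prems(5) le(1,2)] by blast
      then show "\<exists>a\<in>A. \<exists>v. {pos a, v} \<in> E - R \<and> good (pos(a := v))"
      proof
        assume free: "edge i (p - 1) \<notin> R"
        have e: "{pos x, P i (p - 1)} \<in> E - R"
          using free less.prems False by (intro edge_down) auto
        have "good (pos(x := P i (p - 1)))"
          by (rule less.hyps[of "p - 1" q])
            (use False less.prems moved_in_V[OF less.prems(1) e] in auto)
        with e less.prems(2) show ?thesis by blast
      next
        assume free: "edge i q \<notin> R"
        have e: "{pos y, P i (Suc q)} \<in> E - R" using free less.prems le by (intro edge_up) auto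
        have "good (pos(y := P i (Suc q)))"
          by (rule less.hyps[of p "Suc q"])
            (use False less.prems moved_in_V[OF less.prems(1) e] in auto)
        with e less.prems(3) show ?thesis by blast
      qed
    qed
  qed
qed

text \<open>There are more agents than paths, so by the pigeonhole principle two share a
  path.\<close>

lemma all_good:
  assumes "pos ` A \<subseteq> V"
  shows "good pos"
proof -
  have "\<forall>a. \<exists>i. a \<in> A \<longrightarrow> i < l \<and> (\<exists>q. q \<le> Suc (d i) \<and> pos a = P i q)"
    using assms unfolding V_eq by blast
  then obtain ln where ln: "\<And>a. a \<in> A \<Longrightarrow> ln a < l \<and> (\<exists>q. q \<le> Suc (d (ln a)) \<and> pos a = P (ln a) q)"
    by metis
  have "ln ` A \<subseteq> {..<l}" using ln by auto
  then have "card (ln ` A) \<le> l" using card_mono[of "{..<l}" "ln ` A"] by simp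
  then have "\<not> inj_on ln A" using card_A by (auto dest: card_image)
  then obtain x y where xy: "x \<in> A" "y \<in> A" "x \<noteq> y" "ln x = ln y" by (auto simp: inj_on_def)
  obtain p where p: "p \<le> Suc (d (ln x))" "pos x = P (ln x) p" using ln[OF xy(1)] by blast
  obtain q where q: "q \<le> Suc (d (ln x))" "pos y = P (ln x) q" using ln[OF xy(2)] xy(4) by auto
  have i: "ln x < l" using ln[OF xy(1)] by blast
  show ?thesis
    using two_on_path_good[OF assms xy(1,2,3) i p(2) q(2) _ q(1)]
      two_on_path_good[OF assms xy(2,1) xy(3)[symmetric] i q(2) p(2) _ p(1)] by linarith
qed

end

section \<open>Informing the agents one meeting after another\<close>

context theta
begin

text \<open>Induction on the number of ignorant agents. With \<open>I\<close> fixed, the pursuit is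
  played until a meeting enlarges the informed set.\<close>

lemma winning_if_separated:
  assumes "l \<le> k"
  shows "\<lbrakk>pos ` {0..k} \<subseteq> V; I \<subseteq> {0..k}; I \<noteq> {}; \<And>a b. a \<in> I \<Longrightarrow> b \<in> {0..k} - I \<Longrightarrow> pos a \<noteq> pos b\<rbrakk>
    \<Longrightarrow> winning V E k (pos, I)"
proof (induction "card ({0..k} - I)" arbitrary: pos I rule: less_induct)
  case less
  show ?case
  proof (cases "{0..k} - I = {}")
    case True
    then show ?thesis by (intro winning.informed) auto
  next
    case False
    define sep where "sep pos \<longleftrightarrow> (\<forall>a\<in>I. \<forall>b\<in>{0..k} - I. pos a \<noteq> pos b)" for pos :: "nat \<Rightarrow> 'v"
    \<comment> \<open>A meeting makes \<open>good\<close> hold vacuously, as \<open>meet\<close>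
      requires. The actual meeting is treated under \<open>force\<close>, where the informed set
      grows to \<open>J\<close> and the induction hypothesis applies.\<close>
    define good where "good pos \<longleftrightarrow> (pos ` {0..k} \<subseteq> V \<longrightarrow> sep pos \<longrightarrow> winning V E k (pos, I))" for pos
    interpret pursuit l d P V E "{0..k}" I good
    proof
      fix pos :: "nat \<Rightarrow> 'v" and a b
      assume "a \<in> I" "b \<in> {0..k} - I" "pos a = pos b"
      then show "good pos" unfolding good_def sep_def by blast
    next
      fix pos :: "nat \<Rightarrow> 'v"
      assume V: "pos ` {0..k} \<subseteq> V"
        and force: "\<And>R. admissible V E R \<Longrightarrow> \<exists>a\<in>{0..k}. \<exists>v. {pos a, v} \<in> E - R \<and> good (pos(a := v))"
      have "winning V E k (pos, I)"
      proof (rule winning.move)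
        fix R assume "admissible V E R"
        from force[OF this] obtain a v where
          a: "a \<in> {0..k}" "{pos a, v} \<in> E - R" "good (pos(a := v))" by blast
        define npos where "npos = pos(a := v)"
        define J where "J = I \<union> {b. b \<le> k \<and> (\<exists>c\<in>I. c \<le> k \<and> npos c = npos b)}"
        have st: "step k (E - R) (pos, I) npos = (npos, J)"
        proof -
          have "(if npos b = pos b \<or> {pos b, npos b} \<in> E - R then npos b else pos b) = npos b" for b
            using a(2) by (simp add: npos_def)
          then show ?thesis by (simp only: step_def Let_def fst_conv snd_conv J_def)
        qed
        have V': "npos ` {0..k} \<subseteq> V"
          using V edge_subset_V[of "{pos a, v}"] a(2) by (auto simp: npos_def)
        have "winning V E k (npos, J)"
        proof (cases "sep npos")
          case True
          then have "b \<in> I" if "b \<le> k" "c \<in> I" "npos c = npos b" for b c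
            using that unfolding sep_def by force
          then have "J = I" unfolding J_def by blast
          then show ?thesis using a(3) V' True unfolding npos_def good_def by simp
        next
          case False
          then obtain c b where "c \<in> I" "b \<in> {0..k} - I" "npos c = npos b" unfolding sep_def by blast
          moreover from this have "c \<le> k" using less.prems(2) by auto
          ultimately have "b \<in> J" "b \<in> {0..k} - I" unfolding J_def by auto
          then have "{0..k} - J \<subset> {0..k} - I" unfolding J_def by blast
          then have "card ({0..k} - J) < card ({0..k} - I)" by (intro psubset_card_mono) auto
          then show ?thesis
          proof (rule less.hyps[OF _ V'])
            show "J \<subseteq> {0..k}" "J \<noteq> {}" using less.prems(2,3) by (auto simp: J_def)
            \<comment> \<open>\<open>J\<close> contains everybody standing with a member of
              \<open>I\<close>, so the new configuration is separated again.\<close>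
            fix b c assume bc: "b \<in> J" "c \<in> {0..k} - J"
            show "npos b \<noteq> npos c"
            proof
              assume eq: "npos b = npos c"
              obtain e where "e \<in> I" "e \<le> k" "npos e = npos b"
                using bc(1) less.prems(2) unfolding J_def by force
              then have "c \<in> J" using eq bc(2) unfolding J_def by auto
              then show False using bc(2) by blast
            qed
          qed
        qed
        then show "\<exists>tgt. winning V E k (step k (E - R) (pos, I) tgt)"
          by (intro exI[of _ npos]) (simp only: st)
      qed
      then show "good pos" unfolding good_def by blast
    qed (use less.prems False assms in auto)
    have "good pos" using less.prems(1) by (rule all_good)
    then show ?thesis using less.prems unfolding good_def sep_def by blast
  qed
qed

lemma solvable:
  assumes "l \<le> k"
  shows "broadcast_solvable V E k"
proof (rule broadcast_solvableI[OF finite_E])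
  fix p assume p: "inj_on p {0..k}" "p ` {0..k} \<subseteq> V"
  have "p a \<noteq> p b" if "a \<in> {0}" "b \<in> {0..k} - {0}" for a b
    using that inj_onD[OF p(1), of a b] by auto
  with p(2) show "winning V E k (p, {0})"
    by (intro winning_if_separated[OF assms]) auto
qed

end

section \<open>The concrete theta graph\<close>

lemma theta_path_node:
  assumes "l \<ge> 1" and "\<forall>i<l. d i \<ge> 2"
  shows "theta l d (path_node d) (theta_V l d) (theta_E l d)"
proof
  show "theta_V l d = {path_node d i q | i q. i < l \<and> q \<le> Suc (d i)}"
  proof (intro set_eqI iffI)
    fix v assume "v \<in> theta_V l d"
    then consider "v = North" | "v = South" | i j where "v = Inner i j" "i < l" "j < d i"
      by (auto simp: theta_V_def)
    then show "v \<in> {path_node d i q | i q. i < l \<and> q \<le> Suc (d i)}"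
    proof cases
      case 1
      then show ?thesis using assms by (intro CollectI exI[of _ 0]) (simp add: path_node_def)
    next
      case 2
      then show ?thesis using assms
        by (intro CollectI exI[of _ 0] exI[of _ "Suc (d 0)"]) (simp add: path_node_def)
    next
      case 3
      then show ?thesis by (intro CollectI exI[of _ i] exI[of _ "Suc j"]) (simp add: path_node_def)
    qed
  next
    fix v assume "v \<in> {path_node d i q | i q. i < l \<and> q \<le> Suc (d i)}"
    then obtain i q where i: "i < l" "q \<le> Suc (d i)" "v = path_node d i q" by blast
    have "q - 1 < d i" if "q \<noteq> 0" "q \<noteq> Suc (d i)" using that i by linarith
    with i show "v \<in> theta_V l d" unfolding theta_V_def path_node_def by (cases "q = 0") auto
  qed
qed (use assms in \<open>auto simp: theta_E_def path_node_def\<close>)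

theorem theorem2:
  fixes l k :: nat and d :: "nat \<Rightarrow> nat"
  assumes "l \<ge> 1" and "\<forall>i<l. d i \<ge> 3" and "k \<ge> 1"
  shows "broadcast_solvable (theta_V l d) (theta_E l d) k \<longleftrightarrow> k \<ge> l"
proof -
  interpret theta l d "path_node d" "theta_V l d" "theta_E l d"
    using assms(1,2) by (intro theta_path_node) auto
  show ?thesis using solvable not_solvable[OF assms(3)] by (meson not_le)
qed

end
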